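(* Let $m\ge 0$ be an integer and let $\gamma>-m$ be a real number. Let $R(\gamma)\in(0,1)$ be the positive root of the equation $$\frac{x^m}{m+\gamma}-2\sum_{n=m+1}^{\infty}\frac{x^n}{n+\gamma}=0 .$$ Then for every $f\in\mathcal{B}$ of the form $f(z)=\sum_{n=m}^{\infty}a_nz^n$ and every $r$ with $0\le r\le R(\gamma)$, $$\sum_{n=m}^{\infty}\frac{|a_n|}{n+\gamma}\,r^n\le\frac{1}{m+\gamma}\,r^m .$$ Moreover, $R(\gamma)$ cannot be improved: there is no $R'\in(R(\gamma),1)$ such that this inequality holds for all $f\in\mathcal{B}$ of the form $f(z)=\sum_{n=m}^{\infty}a_nz^n$ and all $0\le r\le R'$.
   Context: $\mathbb{D}=\{z\in\mathbb{C}:|z|<1\}$ is the open unit disk, and $\mathcal{B}$ is the set of all analytic functions $f$ on $\mathbb{D}$ with $|f(z)|\le 1$ for all $z\in\mathbb{D}$. The convention $0^0=1$ is used. *)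

theory Defs
  imports "HOL-Complex_Analysis.Complex_Analysis"
begin

definition class_B :: "(complex \<Rightarrow> complex) set" where
  "class_B = {f. f analytic_on ball 0 1 \<and> (\<forall>z\<in>ball 0 1. cmod (f z) \<le> 1)}"

text \<open>A series over \<open>n \<ge> m\<close> is written as a series over all \<open>n\<close> with the summation
  index shifted by \<open>m\<close>; the values \<open>a n\<close> with \<open>n < m\<close> are irrelevant throughout.\<close>

definition expands_from :: "nat \<Rightarrow> (nat \<Rightarrow> complex) \<Rightarrow> (complex \<Rightarrow> complex) \<Rightarrow> bool" where
  "expands_from m a f \<longleftrightarrow> (\<forall>z\<in>ball 0 1. (\<lambda>n. a (n + m) * z ^ (n + m)) sums f z)"

definition majorant_term :: "nat \<Rightarrow> real \<Rightarrow> (nat \<Rightarrow> complex) \<Rightarrow> real \<Rightarrow> nat \<Rightarrow> real" where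
  "majorant_term m \<gamma> a r n = cmod (a (n + m)) / (real (n + m) + \<gamma>) * r ^ (n + m)"

definition bohr_inequality :: "nat \<Rightarrow> real \<Rightarrow> (nat \<Rightarrow> complex) \<Rightarrow> real \<Rightarrow> bool" where
  "bohr_inequality m \<gamma> a r \<longleftrightarrow>
     (\<Sum>n. majorant_term m \<gamma> a r n) \<le> 1 / (real m + \<gamma>) * r ^ m"

text \<open>The restriction to \<open>x < 1\<close> is needed because \<open>suminf\<close> has no meaningful value
  where the series diverges.\<close>

definition is_bohr_root :: "nat \<Rightarrow> real \<Rightarrow> real \<Rightarrow> bool" where
  "is_bohr_root m \<gamma> x \<longleftrightarrow> 0 < x \<and> x < 1 \<and>
     x ^ m / (real m + \<gamma>)
       - 2 * (\<Sum>n. x ^ (n + (m + 1)) / (real (n + (m + 1)) + \<gamma>)) = 0"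

definition bohr_radius :: "nat \<Rightarrow> real \<Rightarrow> real" where
  "bohr_radius m \<gamma> = (THE x. is_bohr_root m \<gamma> x)"

end

theory Submission
  imports Defs
begin

text \<open>Write \<open>c = m + \<gamma>\<close> and \<open>T(x) = (\<Sum>n\<ge>1. x^n / (n + c))\<close>, which is increasing; the Bohr
  radius \<open>R\<close> is the point where \<open>T(R) = 1 / (2 c)\<close>. The coefficients of \<open>f\<close> satisfy
  \<open>|a (m + n)| \<le> 2 (1 - |a m|)\<close>, a weaker bound than Wiener's \<open>1 - |a m|^2\<close> but already
  sufficient: the majorant at \<open>r\<close> is at most \<open>r^m (|a m| / c + 2 (1 - |a m|) T(r))\<close>, hence at
  most \<open>r^m / c\<close> for \<open>r \<le> R\<close>. Beyond \<open>R\<close> the function \<open>z^m (t - z) / (1 - t z)\<close> violates the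
  inequality at \<open>r\<close> for \<open>t = R / r\<close>.\<close>

section \<open>Fourier integrals on circles and coefficient bounds for bounded functions\<close>

text \<open>Cauchy's formula for the \<open>k\<close>-th derivative at 0, parametrised on the circle
  of radius \<open>\<rho>\<close> and read as a Fourier coefficient. Taking
  \<open>\<rho> < 1\<close> avoids any question about boundary values of \<open>f\<close>.\<close>

lemma power_series_circle_integral:
  fixes c :: "nat \<Rightarrow> complex" and \<rho> :: real
  assumes sums: "\<And>z. z \<in> ball 0 1 \<Longrightarrow> (\<lambda>n. c n * z ^ n) sums f z"
    and \<rho>: "0 < \<rho>" "\<rho> < 1"
  shows "((\<lambda>t. f (\<rho> * cis t) * cis (- (real k * t))) has_integral 2 * pi * c k * \<rho> ^ k) {0..2*pi}"
proof -
  have "f holomorphic_on ball 0 1"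
    using power_series_holomorphic[of 0 1 c f] sums by simp
  then have hol: "f holomorphic_on cball 0 \<rho>"
    by (rule holomorphic_on_subset) (use \<rho> in auto)
  have "f has_fps_expansion Abs_fps c"
    by (rule has_fps_expansionI, rule eventually_nhds_in_open[of "ball 0 1", THEN eventually_mono])
      (use sums in auto)
  then have ck: "(deriv ^^ k) f 0 = fact k * c k"
    using fps_nth_fps_expansion[of f "Abs_fps c" k] by simp
  have "((\<lambda>u. f u / (u - 0) ^ Suc k) has_contour_integral
      (2 * pi * \<i>) / fact k * (deriv ^^ k) f 0) (circlepath 0 \<rho>)"
    by (rule Cauchy_has_contour_integral_higher_derivative_circlepath)
      (use \<rho> hol in \<open>auto intro: holomorphic_on_imp_continuous_on holomorphic_on_subset\<close>)
  then have "((\<lambda>u. f u / u ^ Suc k) has_contour_integral 2 * pi * \<i> * c k)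
      (part_circlepath 0 \<rho> 0 (2 * pi))"
    by (simp add: ck circlepath_def mult_ac)
  then have "((\<lambda>t. f (\<rho> * cis t) / (\<rho> * cis t) ^ Suc k * \<rho> * \<i> * cis t) has_integral
      2 * pi * \<i> * c k) {0..2*pi}"
    by (subst (asm) has_contour_integral_part_circlepath_iff) auto
  \<comment> \<open>Apart from \<open>f\<close>, the integrand equals
    \<open>\<i> * cis (- k t) / \<rho> ^ k\<close>; this factor leaves just the Fourier
    kernel.\<close>
  then have "((\<lambda>t. (\<rho> ^ k / \<i>) * (f (\<rho> * cis t) / (\<rho> * cis t) ^ Suc k * \<rho> * \<i> * cis t)) has_integral
      (\<rho> ^ k / \<i>) * (2 * pi * \<i> * c k)) {0..2*pi}"
    by (rule has_integral_mult_right)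
  moreover have "(\<rho> ^ k / \<i>) * (f (\<rho> * cis t) / (\<rho> * cis t) ^ Suc k * \<rho> * \<i> * cis t)
      = f (\<rho> * cis t) * cis (- (real k * t))" for t
    using \<rho> by (simp add: power_mult_distrib Complex.DeMoivre field_simps flip: cis_inverse)
  ultimately show ?thesis by (simp add: mult_ac)
qed

text \<open>Integrating \<open>z\<^sup>-\<^sup>m f\<close> against the kernel \<open>1 + cos (n t - \<phi>)\<close>, which is nonnegative and
  has mean \<open>1\<close>, picks out \<open>c m\<close> plus half of a rotation of \<open>c (m + n)\<close>.\<close>

lemma bounded_power_series_coeff_bound:
  fixes c :: "nat \<Rightarrow> complex"
  assumes sums: "\<And>z. z \<in> ball 0 1 \<Longrightarrow> (\<lambda>n. c n * z ^ n) sums f z"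
    and bounded: "\<And>z. z \<in> ball 0 1 \<Longrightarrow> cmod (f z) \<le> 1"
    and low: "\<And>j. j < m \<Longrightarrow> c j = 0" and n: "n > 0"
  shows "cmod (c m) + cmod (c (m + n)) / 2 \<le> 1"
proof -
  have *: "cmod (c m) * \<rho> ^ m + cmod (c (m + n)) / 2 * \<rho> ^ (m + n) \<le> 1"
    if \<rho>: "0 < \<rho>" "\<rho> < 1" for \<rho> :: real
  proof -
    \<comment> \<open>This phase gives \<open>cis \<phi> * c (m + n)\<close> the argument of
      \<open>c m\<close>, so that the two terms of \<open>J\<close> below add up without
      cancellation.\<close>
    define \<phi> where "\<phi> = Arg (c m) - Arg (c (m + n))"
    define F where "F = (\<lambda>t. f (\<rho> * cis t))"
    have I0: "((\<lambda>t. F t * cis (- (real m * t))) has_integral 2 * pi * c m * \<rho> ^ m) {0..2*pi}"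
      and I1: "((\<lambda>t. F t * cis (- (real (m + n) * t))) has_integral
        2 * pi * c (m + n) * \<rho> ^ (m + n)) {0..2*pi}"
      unfolding F_def using sums \<rho> by (rule power_series_circle_integral; simp)+
    \<comment> \<open>The remaining Fourier mode has index \<open>m - n\<close>, possibly negative,
      while the circle integral takes a natural index. Multiplying \<open>f\<close> by
      \<open>z ^ n\<close> moves the mode to index \<open>m\<close>, where the coefficient is 0:
      either by \<open>low\<close>, as \<open>m - n < m\<close>, or because the shifted series
      starts later.\<close>
    have "(\<lambda>j. (if j < n then 0 else c (j - n)) * z ^ j) sums (f z * z ^ n)"
      if z: "z \<in> ball 0 1" for z
    proof (subst sums_zero_iff_shift[of n, symmetric])
      show "(\<lambda>j. (if j + n < n then 0 else c (j + n - n)) * z ^ (j + n)) sums (f z * z ^ n)"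
        using sums_mult2[OF sums[OF z], of "z ^ n"] by (simp add: power_add mult_ac)
    qed auto
    then have "((\<lambda>t. f (\<rho> * cis t) * (\<rho> * cis t) ^ n * cis (- (real m * t))) has_integral
        2 * pi * (if m < n then 0 else c (m - n)) * \<rho> ^ m) {0..2*pi}"
      using \<rho> by (rule power_series_circle_integral)
    moreover have "(if m < n then 0 else c (m - n)) = 0"
      using low n by auto
    ultimately have "((\<lambda>t. f (\<rho> * cis t) * (\<rho> * cis t) ^ n * cis (- (real m * t))) has_integral 0)
        {0..2*pi}"
      by simp
    from has_integral_mult_right[OF this, of "1 / \<rho> ^ n"]
    have I2: "((\<lambda>t. F t * cis (real n * t) * cis (- (real m * t))) has_integral 0) {0..2*pi}"
      using \<rho> by (simp add: F_def power_mult_distrib Complex.DeMoivre mult_ac)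
    define J where "J = 2 * pi * c m * \<rho> ^ m + (cis \<phi> / 2) * (2 * pi * c (m + n) * \<rho> ^ (m + n))"
    \<comment> \<open>The kernel \<open>1 + cos (n t - \<phi>)\<close> is split into its three
      exponentials; the last one integrates to 0 by \<open>I2\<close>.\<close>
    have "((\<lambda>t. F t * cis (- (real m * t))
        + (cis \<phi> / 2) * (F t * cis (- (real (m + n) * t)))
        + (cis (- \<phi>) / 2) * (F t * cis (real n * t) * cis (- (real m * t))))
      has_integral J + (cis (- \<phi>) / 2) * 0) {0..2*pi}"
      unfolding J_def by (intro has_integral_add has_integral_mult_right I0 I1 I2)
    moreover have "F t * cis (- (real m * t))
        + (cis \<phi> / 2) * (F t * cis (- (real (m + n) * t)))
        + (cis (- \<phi>) / 2) * (F t * cis (real n * t) * cis (- (real m * t)))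
      = F t * cis (- (real m * t)) * of_real (1 + cos (real n * t - \<phi>))" for t
    proof -
      have "complex_of_real (cos x) = (cis x + cis (- x)) / 2" for x
        by (simp add: complex_eq_iff)
      then have "of_real (cos (real n * t - \<phi>)) = (cis (real n * t - \<phi>) + cis (\<phi> - real n * t)) / 2"
        by (metis minus_diff_eq)
      moreover have "cis (real n * t - \<phi>) = cis (real n * t) * cis (- \<phi>)"
        "cis (\<phi> - real n * t) = cis \<phi> * cis (- (real n * t))"
        "cis (- (real (m + n) * t)) = cis (- (real m * t)) * cis (- (real n * t))"
        by (simp_all add: cis_mult algebra_simps)
      ultimately show ?thesis
        by (simp add: algebra_simps add_divide_distrib)
    qed
    ultimately have int: "((\<lambda>t. F t * cis (- (real m * t)) * of_real (1 + cos (real n * t - \<phi>)))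
        has_integral J) {0..2*pi}"
      by simp
    have "((\<lambda>t. 1 + cos (real n * t - \<phi>)) has_integral
        (2*pi + sin (real n * (2*pi) - \<phi>) / n) - (0 + sin (real n * 0 - \<phi>) / n)) {0..2*pi}"
      by (rule fundamental_theorem_of_calculus)
        (use n in \<open>auto intro!: derivative_eq_intros
          simp flip: has_real_derivative_iff_has_vector_derivative\<close>)
    moreover have "sin (real n * (2*pi) - \<phi>) = sin (- \<phi>)"
      using sin_cos_npi[of "2 * n"] cos_npi[of "2 * n"] sin_npi[of "2 * n"]
      by (simp add: sin_diff mult_ac)
    ultimately have kernel: "((\<lambda>t. 1 + cos (real n * t - \<phi>)) has_integral 2*pi) {0..2*pi}"
      by simp
    have "cmod (F t * cis (- (real m * t)) * of_real (1 + cos (real n * t - \<phi>)))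
        \<le> 1 + cos (real n * t - \<phi>)" for t
    proof -
      have pos: "0 \<le> 1 + cos (real n * t - \<phi>)"
        using cos_ge_minus_one[of "real n * t - \<phi>"] by linarith
      have "cmod (F t) \<le> 1"
        unfolding F_def by (rule bounded) (use \<rho> in \<open>simp add: norm_mult\<close>)
      then have "cmod (F t) * (1 + cos (real n * t - \<phi>)) \<le> 1 * (1 + cos (real n * t - \<phi>))"
        using pos by (rule mult_right_mono)
      then show ?thesis
        using pos by (simp only: norm_mult norm_cis norm_of_real abs_of_nonneg mult_1 mult_1_right)
    qed
    from Henstock_Kurzweil_Integration.integral_norm_bound_integral
      [OF has_integral_integrable[OF int] has_integral_integrable[OF kernel] this]
    have "cmod J \<le> 2 * pi"
      by (simp only: integral_unique[OF int] integral_unique[OF kernel])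
    moreover have "J = 2 * pi * cis (Arg (c m)) *
        of_real (cmod (c m) * \<rho> ^ m + cmod (c (m + n)) / 2 * \<rho> ^ (m + n))"
    proof -
      have polar: "z = of_real (cmod z) * cis (Arg z)" for z
        using rcis_cmod_Arg[of z] by (simp add: rcis_def)
      have "cis \<phi> * c (m + n) = cis (Arg (c m)) * cmod (c (m + n))"
        by (subst polar[of "c (m + n)"]) (simp add: \<phi>_def cis_mult mult_ac)
      moreover have "c m = cmod (c m) * cis (Arg (c m))"
        by (rule polar)
      ultimately show ?thesis
        unfolding J_def by (simp add: algebra_simps)
    qed
    then have "cmod J = 2 * pi * (cmod (c m) * \<rho> ^ m + cmod (c (m + n)) / 2 * \<rho> ^ (m + n))"
      using \<rho> by (simp only: norm_mult norm_cis norm_of_real) simp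
    ultimately show ?thesis by simp
  qed
  \<comment> \<open>The bound at each radius below 1 is a polynomial inequality in
    \<open>\<rho>\<close>, hence passes to the limit 1.\<close>
  have "((\<lambda>\<rho>. cmod (c m) * \<rho> ^ m + cmod (c (m + n)) / 2 * \<rho> ^ (m + n)) \<longlongrightarrow>
      cmod (c m) * 1 ^ m + cmod (c (m + n)) / 2 * 1 ^ (m + n)) (at_left 1)"
    by (intro tendsto_intros)
  then have "cmod (c m) * 1 ^ m + cmod (c (m + n)) / 2 * 1 ^ (m + n) \<le> 1"
  proof (rule tendsto_upperbound)
    have "eventually (\<lambda>\<rho>::real. \<rho> \<in> {0<..<1}) (at_left 1)"
      by (rule eventually_at_left_real) simp
    then show "\<forall>\<^sub>F \<rho> in at_left 1. cmod (c m) * \<rho> ^ m + cmod (c (m + n)) / 2 * \<rho> ^ (m + n) \<le> 1"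
      by eventually_elim (use * in auto)
  qed simp
  then show ?thesis by simp
qed

text \<open>Used in two ways: as \<open>cmod (a (n + m)) \<le> 2 * (1 - cmod (a m))\<close>, and as
  a source of \<open>cmod (a m) \<le> 1\<close>.\<close>

lemma class_B_coeff_bound:
  assumes "f \<in> class_B" "expands_from m a f" "n > 0"
  shows "cmod (a m) + cmod (a (n + m)) / 2 \<le> 1"
proof -
  \<comment> \<open>\<open>expands_from\<close> says nothing about \<open>a j\<close> for
    \<open>j < m\<close>; filling in 0 yields the full Taylor sequence of \<open>f\<close>.\<close>
  define c where "c = (\<lambda>j. if j < m then 0 else a j)"
  have "(\<lambda>j. c j * z ^ j) sums f z" if "z \<in> ball 0 1" for z
    by (subst sums_zero_iff_shift[of m, symmetric])
      (use assms(2) that in \<open>auto simp: c_def expands_from_def\<close>)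
  moreover have "cmod (f z) \<le> 1" if "z \<in> ball 0 1" for z
    using assms(1) that by (auto simp: class_B_def)
  ultimately have "cmod (c m) + cmod (c (m + n)) / 2 \<le> 1"
    by (rule bounded_power_series_coeff_bound) (use assms(3) in \<open>auto simp: c_def\<close>)
  then show ?thesis by (simp add: c_def add.commute)
qed

section \<open>The tail series and the Bohr radius as its unique solution point\<close>

text \<open>The function \<open>T\<close> of the overview, equal to \<open>x\<close> times the Lerch
  transcendent with parameters \<open>x\<close>, 1, \<open>c + 1\<close>. Once \<open>x ^ m\<close>
  is taken out, \<open>m\<close> and \<open>\<gamma>\<close> enter only through their sum
  \<open>c\<close>.\<close>

definition bohr_tail :: "real \<Rightarrow> real \<Rightarrow> real" where
  "bohr_tail c x = (\<Sum>n. x ^ (n + 1) / (real (n + 1) + c))"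

lemma summable_power_div_add:
  fixes c x :: real
  assumes "c > 0" "0 \<le> x" "x < 1"
  shows "summable (\<lambda>n. x ^ n / (real n + c))"
proof (rule summable_comparison_test_ev)
  show "summable (\<lambda>n. x ^ n / c)"
    using assms by (intro summable_divide summable_geometric) auto
  show "\<forall>\<^sub>F n in sequentially. norm (x ^ n / (real n + c)) \<le> x ^ n / c"
    using assms by (intro always_eventually allI) (auto intro!: divide_left_mono)
qed

lemma summable_bohr_tail:
  assumes "c > 0" "0 \<le> x" "x < 1"
  shows "summable (\<lambda>n. x ^ (n + 1) / (real (n + 1) + c))"
  using summable_ignore_initial_segment[OF summable_power_div_add[OF assms], of 1] by simp

lemma bohr_tail_strict_mono:
  assumes "c > 0" "0 \<le> x" "x < y" "y < 1"
  shows "bohr_tail c x < bohr_tail c y"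
proof -
  let ?d = "\<lambda>n. y ^ (n + 1) / (real (n + 1) + c) - x ^ (n + 1) / (real (n + 1) + c)"
  have sx: "summable (\<lambda>n. x ^ (n + 1) / (real (n + 1) + c))"
    and sy: "summable (\<lambda>n. y ^ (n + 1) / (real (n + 1) + c))"
    using assms by (intro summable_bohr_tail; simp)+
  have "0 < suminf ?d"
  proof (rule suminf_pos)
    show "0 < ?d n" for n
      using assms power_strict_mono[of x y "n + 1"]
      by (simp del: of_nat_add power_Suc add: divide_strict_right_mono)
  qed (intro summable_diff sx sy)
  then show ?thesis
    unfolding bohr_tail_def suminf_diff[OF sy sx, symmetric] by simp
qed

lemma continuous_on_bohr_tail:
  assumes "c > 0" "y < 1"
  shows "continuous_on {0..y} (bohr_tail c)"
proof -
  have eq: "bohr_tail c x = x * (\<Sum>n. 1 / (real (n + 1) + c) * x ^ n)" if "x \<in> {0..y}" for x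
  proof (cases "x = 0")
    case False
    have "summable (\<lambda>n. 1 / x * (x ^ (n + 1) / (real (n + 1) + c)))"
      using that assms by (intro summable_mult summable_bohr_tail) auto
    then have "summable (\<lambda>n. 1 / (real (n + 1) + c) * x ^ n)"
      using False by simp
    from suminf_mult[OF this, of x] show ?thesis
      by (simp add: bohr_tail_def)
  qed (simp add: bohr_tail_def)
  \<comment> \<open>A point strictly between \<open>y\<close> and 1, and positive even for negative
    \<open>y\<close>. Convergence of the power series at \<open>K\<close> gives continuity wherever
    \<open>\<bar>x\<bar> < K\<close>.\<close>
  define K where "K = (1 + max 0 y) / 2"
  have K: "0 < K" "K < 1" "y < K"
    using assms by (auto simp: K_def max_def)
  have "summable (\<lambda>n. 1 / K * (K ^ (n + 1) / (real (n + 1) + c)))"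
    using K assms by (intro summable_mult summable_bohr_tail) auto
  then have "summable (\<lambda>n. 1 / (real (n + 1) + c) * K ^ n)"
    using K by simp
  then have "continuous_on {0..y} (\<lambda>x. x * (\<Sum>n. 1 / (real (n + 1) + c) * x ^ n))"
    using K by (intro continuous_intros continuous_at_imp_continuous_on ballI isCont_powser) auto
  then show ?thesis
    by (subst continuous_on_cong[OF refl eq])
qed

text \<open>At \<open>x = 1\<close> the series diverges like the harmonic series, so some partial
  sum there exceeds \<open>B\<close>. A finite sum is continuous, so it still exceeds
  \<open>B\<close> slightly to the left of 1, and it is a lower bound for the tail as all terms are
  nonnegative.\<close>

lemma bohr_tail_unbounded:
  assumes "c > 0"
  obtains x where "0 < x" "x < 1" "B < bohr_tail c x"
proof -
  have "\<not> summable (\<lambda>n. 1 / (real (n + 1) + c))"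
  proof
    assume "summable (\<lambda>n. 1 / (real (n + 1) + c))"
    \<comment> \<open>The constant comes from
      \<open>n + 1 + c \<le> (1 + c) * (n + 1)\<close>.\<close>
    then have "summable (\<lambda>n. (1 + c) * (1 / (real (n + 1) + c)))"
      by (rule summable_mult)
    then have "summable (\<lambda>n. inverse (real (Suc n)))"
    proof (rule summable_comparison_test_ev[rotated])
      have "norm (inverse (real (Suc n))) \<le> (1 + c) * (1 / (real (n + 1) + c))" for n
        using assms by (auto simp: field_simps)
      then show "\<forall>\<^sub>F n in sequentially.
          norm (inverse (real (Suc n))) \<le> (1 + c) * (1 / (real (n + 1) + c))"
        by (rule always_eventually[OF allI])
    qed
    then have "summable (\<lambda>n. inverse (real n))"
      using summable_Suc_iff[of "\<lambda>n. inverse (real n)"] by simp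
    then show False
      using not_summable_harmonic[where 'a = real] by simp
  qed
  then have "\<exists>N. B < (\<Sum>n<N. 1 / (real (n + 1) + c))"
    using bounded_imp_summable[of "\<lambda>n. 1 / (real (n + 1) + c)" B] assms
    by (metis add_nonneg_nonneg lessThan_Suc_atMost less_eq_real_def not_le of_nat_0_le_iff zero_le_divide_1_iff)
  then obtain N where N: "B < (\<Sum>n<N. 1 ^ (n + 1) / (real (n + 1) + c))"
    by auto
  have "((\<lambda>x. \<Sum>n<N. x ^ (n + 1) / (real (n + 1) + c)) \<longlongrightarrow>
      (\<Sum>n<N. 1 ^ (n + 1) / (real (n + 1) + c))) (at_left 1)"
    using assms by (intro tendsto_intros) (auto simp: add_nonneg_eq_0_iff)
  then have "\<forall>\<^sub>F x in at_left 1. B < (\<Sum>n<N. x ^ (n + 1) / (real (n + 1) + c))"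
    using N by (rule order_tendstoD)
  moreover have "eventually (\<lambda>x::real. x \<in> {0<..<1}) (at_left 1)"
    by (rule eventually_at_left_real) simp
  ultimately have "\<forall>\<^sub>F x in at_left 1. x \<in> {0<..<1} \<and> B < bohr_tail c x"
  proof eventually_elim
    case (elim x)
    have "(\<Sum>n<N. x ^ (n + 1) / (real (n + 1) + c)) \<le> bohr_tail c x"
      unfolding bohr_tail_def using elim assms
      by (intro sum_le_suminf summable_bohr_tail) auto
    with elim show ?case by simp
  qed
  then obtain x where "x \<in> {0<..<1}" "B < bohr_tail c x"
    using eventually_happens'[OF trivial_limit_at_left_real] by blast
  then show thesis
    using that by auto
qed

text \<open>Existence is the intermediate value theorem between the value 0 at 0 and a value above
  \<open>B\<close>; uniqueness is strict monotonicity.\<close>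

lemma bohr_tail_eq_ex1:
  assumes c: "c > 0" and B: "B > 0"
  shows "\<exists>!x. 0 < x \<and> x < 1 \<and> bohr_tail c x = B"
proof (rule ex_ex1I)
  obtain y where y: "0 < y" "y < 1" "B < bohr_tail c y"
    using bohr_tail_unbounded[OF c] by blast
  have 0: "bohr_tail c 0 = 0"
    by (simp add: bohr_tail_def)
  obtain x where "0 \<le> x" "x \<le> y" "bohr_tail c x = B"
    using IVT'[of "bohr_tail c" 0 B y] continuous_on_bohr_tail[OF c y(2)] y B 0 by auto
  then show "\<exists>x. 0 < x \<and> x < 1 \<and> bohr_tail c x = B"
    using 0 y B by (intro exI[of _ x]) (auto simp: order_less_le)
next
  fix x y
  assume "0 < x \<and> x < 1 \<and> bohr_tail c x = B" "0 < y \<and> y < 1 \<and> bohr_tail c y = B"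
  then show "x = y"
    using bohr_tail_strict_mono[OF c, of x y] bohr_tail_strict_mono[OF c, of y x]
    by (cases x y rule: linorder_cases) auto
qed

lemma summable_shifted_bohr_tail:
  assumes "\<gamma> > - real m" "0 \<le> x" "x < 1"
  shows "summable (\<lambda>n. x ^ (n + (m + 1)) / (real (n + (m + 1)) + \<gamma>))"
    and "(\<Sum>n. x ^ (n + (m + 1)) / (real (n + (m + 1)) + \<gamma>)) = x ^ m * bohr_tail (real m + \<gamma>) x"
proof -
  have eq: "x ^ (n + (m + 1)) / (real (n + (m + 1)) + \<gamma>)
      = x ^ m * (x ^ (n + 1) / (real (n + 1) + (real m + \<gamma>)))" for n
    by (simp add: power_add mult_ac add_ac)
  have s: "summable (\<lambda>n. x ^ (n + 1) / (real (n + 1) + (real m + \<gamma>)))"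
    using assms by (intro summable_bohr_tail) auto
  show "summable (\<lambda>n. x ^ (n + (m + 1)) / (real (n + (m + 1)) + \<gamma>))"
    unfolding eq by (rule summable_mult[OF s])
  show "(\<Sum>n. x ^ (n + (m + 1)) / (real (n + (m + 1)) + \<gamma>)) = x ^ m * bohr_tail (real m + \<gamma>) x"
    unfolding eq bohr_tail_def by (rule suminf_mult[OF s])
qed

lemma is_bohr_root_iff:
  assumes "\<gamma> > - real m"
  shows "is_bohr_root m \<gamma> x \<longleftrightarrow>
    0 < x \<and> x < 1 \<and> bohr_tail (real m + \<gamma>) x = 1 / (2 * (real m + \<gamma>))"
proof (cases "0 < x \<and> x < 1")
  case True
  \<comment> \<open>The factor \<open>2 * x ^ m\<close> is nonzero for \<open>x > 0\<close>, so the
    root equation is the vanishing of the bracket.\<close>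
  have "x ^ m / (real m + \<gamma>) - 2 * (\<Sum>n. x ^ (n + (m + 1)) / (real (n + (m + 1)) + \<gamma>))
      = 2 * x ^ m * (1 / (2 * (real m + \<gamma>)) - bohr_tail (real m + \<gamma>) x)"
    using True assms by (subst summable_shifted_bohr_tail(2)) (auto simp: field_simps)
  then show ?thesis
    using True unfolding is_bohr_root_def by auto
qed (auto simp: is_bohr_root_def)

lemma bohr_root_ex1:
  assumes "\<gamma> > - real m"
  shows "\<exists>!x. is_bohr_root m \<gamma> x"
  unfolding is_bohr_root_iff[OF assms] using assms by (intro bohr_tail_eq_ex1) auto

text \<open>Unique existence justifies the definite description; from here on the radius is used
  only through these three facts.\<close>

lemma bohr_radius:
  assumes "\<gamma> > - real m"
  shows "0 < bohr_radius m \<gamma>" "bohr_radius m \<gamma> < 1"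
    "bohr_tail (real m + \<gamma>) (bohr_radius m \<gamma>) = 1 / (2 * (real m + \<gamma>))"
proof -
  have "is_bohr_root m \<gamma> (bohr_radius m \<gamma>)"
    unfolding bohr_radius_def by (rule theI'[OF bohr_root_ex1[OF assms]])
  then show "0 < bohr_radius m \<gamma>" "bohr_radius m \<gamma> < 1"
    "bohr_tail (real m + \<gamma>) (bohr_radius m \<gamma>) = 1 / (2 * (real m + \<gamma>))"
    unfolding is_bohr_root_iff[OF assms] by auto
qed

section \<open>Convergence of the majorant and the inequality up to the radius\<close>

text \<open>The coefficients are uniformly bounded, so the majorant is dominated by a convergent
  series. This makes its \<open>suminf\<close> a genuine sum, which can be split and
  compared.\<close>

lemma majorant_term_summable:
  assumes \<gamma>: "\<gamma> > - real m" and f: "f \<in> class_B" "expands_from m a f"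
    and r: "0 \<le> r" "r < 1"
  shows "summable (majorant_term m \<gamma> a r)"
proof (rule summable_comparison_test_ev)
  show "summable (\<lambda>n. 2 * r ^ m * (r ^ n / (real n + (real m + \<gamma>))))"
    using \<gamma> r by (intro summable_mult summable_power_div_add) auto
  have "norm (majorant_term m \<gamma> a r n) \<le> 2 * r ^ m * (r ^ n / (real n + (real m + \<gamma>)))" for n
  proof -
    \<comment> \<open>The coefficient bound concerns positive shifts, so for \<open>n = 0\<close> it
      is applied with shift 1 and the other term dropped.\<close>
    have "cmod (a (n + m)) \<le> 2"
    proof (cases "n = 0")
      case True
      have "cmod (a m) + cmod (a (1 + m)) / 2 \<le> 1"
        by (rule class_B_coeff_bound[OF f]) simp
      then show ?thesis
        using True norm_ge_zero[of "a (1 + m)"] by (simp del: norm_ge_zero)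
    next
      case False
      then have "cmod (a m) + cmod (a (n + m)) / 2 \<le> 1"
        by (intro class_B_coeff_bound[OF f]) simp
      then show ?thesis
        using norm_ge_zero[of "a m"] by linarith
    qed
    then have "cmod (a (n + m)) * (r ^ m * (r ^ n / (real n + (real m + \<gamma>))))
        \<le> 2 * (r ^ m * (r ^ n / (real n + (real m + \<gamma>))))"
      using \<gamma> r by (intro mult_right_mono) auto
    then show ?thesis
      using \<gamma> r by (simp add: majorant_term_def power_add abs_mult mult_ac add_ac)
  qed
  then show "\<forall>\<^sub>F n in sequentially. norm (majorant_term m \<gamma> a r n)
      \<le> 2 * r ^ m * (r ^ n / (real n + (real m + \<gamma>)))"
    by (rule always_eventually[OF allI])
qed

lemma bohr_inequality_within_radius:
  assumes \<gamma>: "\<gamma> > - real m" and f: "f \<in> class_B" "expands_from m a f"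
    and r: "0 \<le> r" "r \<le> bohr_radius m \<gamma>"
  shows "bohr_inequality m \<gamma> a r"
proof -
  define c where "c = real m + \<gamma>"
  define t where "t = cmod (a m)"
  have c: "c > 0" using \<gamma> by (simp add: c_def)
  note R = bohr_radius[OF \<gamma>, folded c_def]
  have r1: "r < 1" using r R by simp
  have t: "t \<le> 1"
    using class_B_coeff_bound[OF f, of 1] norm_ge_zero[of "a (1 + m)"] by (simp add: t_def del: norm_ge_zero)
  have tail: "bohr_tail c r \<le> 1 / (2 * c)"
    using bohr_tail_strict_mono[OF c r(1) _ R(2)] R(3) r(2) by (cases "r = bohr_radius m \<gamma>") auto
  have S: "summable (majorant_term m \<gamma> a r)"
    by (rule majorant_term_summable[OF \<gamma> f r(1) r1])
  note tl = summable_shifted_bohr_tail[OF \<gamma> r(1) r1, folded c_def]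
  have "(\<Sum>n. majorant_term m \<gamma> a r (n + 1))
      \<le> (\<Sum>n. 2 * (1 - t) * (r ^ (n + (m + 1)) / (real (n + (m + 1)) + \<gamma>)))"
  proof (rule suminf_le)
    show "summable (\<lambda>n. majorant_term m \<gamma> a r (n + 1))"
      using S by (rule summable_ignore_initial_segment)
    show "summable (\<lambda>n. 2 * (1 - t) * (r ^ (n + (m + 1)) / (real (n + (m + 1)) + \<gamma>)))"
      by (rule summable_mult[OF tl(1)])
    fix n
    have "cmod (a (n + 1 + m)) \<le> 2 * (1 - t)"
      using class_B_coeff_bound[OF f, of "n + 1"] by (simp add: t_def)
    then have "cmod (a (n + 1 + m)) * (r ^ (n + (m + 1)) / (real (n + (m + 1)) + \<gamma>))
        \<le> 2 * (1 - t) * (r ^ (n + (m + 1)) / (real (n + (m + 1)) + \<gamma>))"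
      using \<gamma> r by (intro mult_right_mono) auto
    then show "majorant_term m \<gamma> a r (n + 1)
        \<le> 2 * (1 - t) * (r ^ (n + (m + 1)) / (real (n + (m + 1)) + \<gamma>))"
      by (simp add: majorant_term_def add_ac)
  qed
  also have "\<dots> = 2 * (1 - t) * (r ^ m * bohr_tail c r)"
    unfolding suminf_mult[OF tl(1)] tl(2) ..
  \<comment> \<open>Here \<open>1 - t \<ge> 0\<close> preserves the inequality. The result
    \<open>(1 - t) * r ^ m / c\<close> is exactly what the leading term \<open>t * r ^ m / c\<close>
    leaves of the allowed total.\<close>
  also have "\<dots> \<le> 2 * (1 - t) * (r ^ m * (1 / (2 * c)))"
    using tail t r by (intro mult_left_mono) auto
  also have "\<dots> = (1 - t) * r ^ m / c"
    using c by (simp add: field_simps)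
  finally have "(\<Sum>n. majorant_term m \<gamma> a r (n + 1)) \<le> (1 - t) * r ^ m / c" .
  moreover have "(\<Sum>n. majorant_term m \<gamma> a r n)
      = (\<Sum>n. majorant_term m \<gamma> a r (n + 1)) + t * r ^ m / c"
    using suminf_split_initial_segment[OF S, of 1]
    by (simp add: t_def c_def) (simp add: majorant_term_def)
  ultimately have "(\<Sum>n. majorant_term m \<gamma> a r n) \<le> (1 - t) * r ^ m / c + t * r ^ m / c"
    by linarith
  also have "\<dots> = 1 / c * r ^ m"
    by (simp add: algebra_simps flip: add_divide_distrib)
  finally show ?thesis
    by (simp only: bohr_inequality_def c_def)
qed

section \<open>Extremal functions and sharpness of the radius\<close>

text \<open>Taylor coefficients of \<open>z ^ m * (t - z) / (1 - t * z)\<close>. The first branch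
  supplies the leading coefficient \<open>t\<close> at \<open>n = m\<close>; in the second,
  \<open>n > m\<close>, so the natural subtraction does not truncate.\<close>

definition blaschke_coeff :: "nat \<Rightarrow> real \<Rightarrow> nat \<Rightarrow> complex" where
  "blaschke_coeff m t n = of_real (if n \<le> m then t else - (1 - t\<^sup>2) * t ^ (n - m - 1))"

text \<open>For \<open>0 \<le> t < 1\<close>, \<open>z ^ m\<close> times the disk automorphism
  exchanging 0 and \<open>t\<close>.\<close>

definition blaschke_power :: "nat \<Rightarrow> real \<Rightarrow> complex \<Rightarrow> complex" where
  "blaschke_power m t z = z ^ m * (of_real t - z) / (1 - of_real t * z)"

lemma blaschke_denominator_nonzero:
  fixes t :: real and z :: complex
  assumes "0 \<le> t" "t < 1" "cmod z < 1"
  shows "1 - of_real t * z \<noteq> 0"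
proof
  assume "1 - of_real t * z = 0"
  then have "t * cmod z = 1"
    using assms by (metis abs_of_nonneg eq_iff_diff_eq_0 norm_mult norm_of_real norm_one)
  moreover have "t * cmod z \<le> t * 1"
    using assms by (intro mult_left_mono) auto
  ultimately show False using assms by simp
qed

lemma blaschke_power_in_class_B:
  assumes t: "0 \<le> t" "t < 1"
  shows "blaschke_power m t \<in> class_B"
proof -
  have "cmod (blaschke_power m t z) \<le> 1" if z: "cmod z < 1" for z
  proof -
    \<comment> \<open>This identity is why the automorphism maps the disk into itself: its right
      side is nonnegative there.\<close>
    have "(cmod (1 - of_real t * z))\<^sup>2 - (cmod (of_real t - z))\<^sup>2 = (1 - t\<^sup>2) * (1 - (cmod z)\<^sup>2)"
      by (simp add: cmod_power2) (simp add: power2_eq_square algebra_simps)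
    moreover have "0 \<le> (1 - t\<^sup>2) * (1 - (cmod z)\<^sup>2)"
      using t z by (intro mult_nonneg_nonneg) (simp_all add: power_le_one)
    ultimately have "cmod (of_real t - z) \<le> cmod (1 - of_real t * z)"
      by - (rule power2_le_imp_le, linarith, simp)
    moreover have "cmod (z ^ m) \<le> 1"
      using z by (simp add: norm_power power_le_one)
    ultimately have "cmod (z ^ m) * cmod (of_real t - z) \<le> 1 * cmod (1 - of_real t * z)"
      by (intro mult_mono) auto
    then show ?thesis
      using blaschke_denominator_nonzero[OF t z]
      by (simp add: blaschke_power_def norm_mult norm_divide)
  qed
  moreover have "blaschke_power m t analytic_on ball 0 1"
    unfolding blaschke_power_def
    by (intro analytic_intros) (use blaschke_denominator_nonzero[OF t] in auto)
  ultimately show ?thesis by (simp add: class_B_def)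
qed

lemma blaschke_power_expands_from:
  assumes t: "0 \<le> t" "t < 1"
  shows "expands_from m (blaschke_coeff m t) (blaschke_power m t)"
  unfolding expands_from_def
proof
  fix z :: complex
  assume "z \<in> ball 0 1"
  then have z: "cmod z < 1" by simp
  note nz = blaschke_denominator_nonzero[OF t z]
  have "t * cmod z < 1"
    using t z mult_right_mono[of t 1 "cmod z"] by simp
  then have "(\<lambda>n. (of_real t * z) ^ n) sums (1 / (1 - of_real t * z))"
    using t by (intro geometric_sums) (simp add: norm_mult)
  \<comment> \<open>Based on \<open>(t - z) / (1 - t * z) = t - (1 - t^2) * z / (1 - t * z)\<close>
    and the geometric series; the term \<open>t * z ^ m\<close> is put back by
    \<open>sums_Suc\<close> below.\<close>
  then have "(\<lambda>n. - (1 - of_real (t\<^sup>2)) * z ^ (m + 1) * (of_real t * z) ^ n)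
      sums (- (1 - of_real (t\<^sup>2)) * z ^ (m + 1) * (1 / (1 - of_real t * z)))"
    by (rule sums_mult)
  moreover have "- (1 - of_real (t\<^sup>2)) * z ^ (m + 1) * (of_real t * z) ^ n
      = blaschke_coeff m t (Suc n + m) * z ^ (Suc n + m)" for n
    by (simp add: blaschke_coeff_def power_add power_mult_distrib)
  ultimately have "(\<lambda>n. blaschke_coeff m t (Suc n + m) * z ^ (Suc n + m))
      sums (- (1 - of_real (t\<^sup>2)) * z ^ (m + 1) * (1 / (1 - of_real t * z)))"
    by (simp only:)
  from sums_Suc[OF this]
  have "(\<lambda>n. blaschke_coeff m t (n + m) * z ^ (n + m))
      sums (- (1 - of_real (t\<^sup>2)) * z ^ (m + 1) * (1 / (1 - of_real t * z)) + of_real t * z ^ m)"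
    by (simp add: blaschke_coeff_def)
  also have "- (1 - of_real (t\<^sup>2)) * z ^ (m + 1) * (1 / (1 - of_real t * z)) + of_real t * z ^ m
      = blaschke_power m t z"
    using nz by (simp add: blaschke_power_def divide_simps) (simp add: algebra_simps power2_eq_square)
  finally show "(\<lambda>n. blaschke_coeff m t (n + m) * z ^ (n + m)) sums blaschke_power m t z" .
qed

text \<open>The powers of \<open>t\<close> in the coefficients merge with those of \<open>r\<close>,
  so the tail is evaluated at \<open>t * r\<close>; one missing power of \<open>t\<close> accounts
  for the division.\<close>

lemma blaschke_majorant_sum:
  assumes \<gamma>: "\<gamma> > - real m" and t: "0 < t" "t < 1" and r: "0 \<le> r" "r < 1"
  shows "(\<Sum>n. majorant_term m \<gamma> (blaschke_coeff m t) r n)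
    = r ^ m * (t / (real m + \<gamma>) + (1 - t\<^sup>2) / t * bohr_tail (real m + \<gamma>) (t * r))"
proof -
  have S: "summable (majorant_term m \<gamma> (blaschke_coeff m t) r)"
    using t by (intro majorant_term_summable[OF \<gamma> blaschke_power_in_class_B blaschke_power_expands_from r]) auto
  have "t\<^sup>2 \<le> 1"
    using t by (simp add: power_le_one)
  then have eq: "majorant_term m \<gamma> (blaschke_coeff m t) r (n + 1)
      = r ^ m * (1 - t\<^sup>2) / t * ((t * r) ^ (n + 1) / (real (n + 1) + (real m + \<gamma>)))" for n
    using t unfolding majorant_term_def blaschke_coeff_def norm_of_real
    by (simp add: abs_mult power_add power_mult_distrib add_ac)
  have "t * r < 1"
    using t r mult_right_mono[of t 1 r] by simp
  then have s: "summable (\<lambda>n. (t * r) ^ (n + 1) / (real (n + 1) + (real m + \<gamma>)))"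
    using \<gamma> t r by (intro summable_bohr_tail) auto
  have "(\<Sum>n. majorant_term m \<gamma> (blaschke_coeff m t) r (n + 1))
      = r ^ m * (1 - t\<^sup>2) / t * bohr_tail (real m + \<gamma>) (t * r)"
    unfolding eq bohr_tail_def by (rule suminf_mult[OF s])
  moreover have "majorant_term m \<gamma> (blaschke_coeff m t) r 0 = r ^ m * (t / (real m + \<gamma>))"
    using t by (simp add: majorant_term_def blaschke_coeff_def)
  ultimately show ?thesis
    using suminf_split_initial_segment[OF S, of 1] by (simp add: distrib_left)
qed

text \<open>With \<open>t = bohr_radius m \<gamma> / r\<close> the tail of the majorant is evaluated at the Bohr radius
  itself, so its value is known exactly.\<close>

lemma bohr_inequality_fails_beyond_radius:
  assumes \<gamma>: "\<gamma> > - real m" and r: "bohr_radius m \<gamma> < r" "r < 1"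
  defines "t \<equiv> bohr_radius m \<gamma> / r"
  shows "\<not> bohr_inequality m \<gamma> (blaschke_coeff m t) r"
proof -
  define c where "c = real m + \<gamma>"
  have c: "c > 0" using \<gamma> by (simp add: c_def)
  note R = bohr_radius[OF \<gamma>, folded c_def]
  have r0: "0 < r" using R r by simp
  have t: "0 < t" "t < 1" and tr: "t * r = bohr_radius m \<gamma>"
    using R r r0 by (simp_all add: t_def)
  have "(\<Sum>n. majorant_term m \<gamma> (blaschke_coeff m t) r n)
      = r ^ m * (t / c + (1 - t\<^sup>2) / t * (1 / (2 * c)))"
    using blaschke_majorant_sum[OF \<gamma> t] r0 r R(3) by (simp add: tr c_def)
  also have "\<dots> = 1 / c * r ^ m * (t + (1 - t\<^sup>2) / (2 * t))"
    using c t by (simp add: field_simps)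
  \<comment> \<open>Completing the square exhibits the excess over 1, strictly positive because
    \<open>r\<close> beyond the radius forces \<open>t < 1\<close>.\<close>
  also have "t + (1 - t\<^sup>2) / (2 * t) = 1 + (1 - t)\<^sup>2 / (2 * t)"
    using t by (simp add: field_simps power2_eq_square)
  also have "1 / c * r ^ m * (1 + (1 - t)\<^sup>2 / (2 * t)) > 1 / c * r ^ m * 1"
    using c r0 t by (intro mult_strict_left_mono) auto
  finally show ?thesis
    by (simp add: bohr_inequality_def c_def)
qed

theorem theorem2p2:
  fixes m :: nat and \<gamma> :: real
  assumes "\<gamma> > - real m"
  shows "(\<exists>!x. is_bohr_root m \<gamma> x)
    \<and> (\<forall>x\<in>{0<..<1}. summable (\<lambda>n. x ^ (n + (m + 1)) / (real (n + (m + 1)) + \<gamma>)))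
    \<and> (\<forall>f\<in>class_B. \<forall>a. expands_from m a f \<longrightarrow>
         (\<forall>r. 0 \<le> r \<and> r < 1 \<longrightarrow> summable (majorant_term m \<gamma> a r)))
    \<and> (\<forall>f\<in>class_B. \<forall>a. expands_from m a f \<longrightarrow>
         (\<forall>r. 0 \<le> r \<and> r \<le> bohr_radius m \<gamma> \<longrightarrow> bohr_inequality m \<gamma> a r))
    \<and> \<not> (\<exists>R'. bohr_radius m \<gamma> < R' \<and> R' < 1 \<and>
         (\<forall>f\<in>class_B. \<forall>a. expands_from m a f \<longrightarrow>
           (\<forall>r. 0 \<le> r \<and> r \<le> R' \<longrightarrow> bohr_inequality m \<gamma> a r)))"
proof (intro conjI ballI allI impI notI)
  show "\<exists>!x. is_bohr_root m \<gamma> x"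
    using assms by (rule bohr_root_ex1)
next
  fix x :: real
  assume "x \<in> {0<..<1}"
  then show "summable (\<lambda>n. x ^ (n + (m + 1)) / (real (n + (m + 1)) + \<gamma>))"
    using assms by (intro summable_shifted_bohr_tail) auto
next
  fix f a and r :: real
  assume "f \<in> class_B" "expands_from m a f" "0 \<le> r \<and> r < 1"
  then show "summable (majorant_term m \<gamma> a r)"
    using assms by (blast intro: majorant_term_summable)
next
  fix f a and r :: real
  assume "f \<in> class_B" "expands_from m a f" "0 \<le> r \<and> r \<le> bohr_radius m \<gamma>"
  then show "bohr_inequality m \<gamma> a r"
    using assms by (blast intro: bohr_inequality_within_radius)
next
  assume "\<exists>R'. bohr_radius m \<gamma> < R' \<and> R' < 1 \<and>
         (\<forall>f\<in>class_B. \<forall>a. expands_from m a f \<longrightarrow>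
           (\<forall>r. 0 \<le> r \<and> r \<le> R' \<longrightarrow> bohr_inequality m \<gamma> a r))"
  then obtain R' where R': "bohr_radius m \<gamma> < R'" "R' < 1"
    and all: "\<And>f a r. f \<in> class_B \<Longrightarrow> expands_from m a f \<Longrightarrow> 0 \<le> r \<Longrightarrow> r \<le> R' \<Longrightarrow>
      bohr_inequality m \<gamma> a r"
    by blast
  \<comment> \<open>The counterexample is tuned to \<open>R'\<close> itself, so the inequality
    already fails at the right endpoint of the supposed range.\<close>
  define t where "t = bohr_radius m \<gamma> / R'"
  have "0 \<le> t" "t < 1" "0 \<le> R'"
    using bohr_radius[OF assms] R' by (simp_all add: t_def)
  then have "bohr_inequality m \<gamma> (blaschke_coeff m t) R'"
    by (intro all[OF blaschke_power_in_class_B blaschke_power_expands_from]) auto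
  then show False
    using bohr_inequality_fails_beyond_radius[OF assms R'] by (simp add: t_def)
qed

end
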